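(* The Okubic affine plane $\mathscr{A}_2(\mathcal{O})$ satisfies the following properties. (1) For any two distinct points $(x_1,y_1)$ and $(x_2,y_2)$ there is a unique line joining them: if $x_1\neq x_2$ it is $[s,\,y_1-s*x_1]$ with $$s=\frac{(x_1-x_2)*(y_1-y_2)}{n(x_1-x_2)},$$ and if $x_1=x_2$ it is $[x_1]$. (2) Two lines $[s_1,t_1]$ and $[s_2,t_2]$ with $s_1\neq s_2$ have a unique point of intersection, namely $(x,\,s_1*x+t_1)$ with $$x=\frac{(t_2-t_1)*(s_1-s_2)}{n(s_1-s_2)}.$$ (3) Two distinct lines with the same slope are disjoint. (4) For each line $[s,t]$ and each point $(x,y)$ there is a unique line which passes through $(x,y)$ and is parallel to $[s,t]$, namely $[s,\,y-s*x]$.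
   Context: The real Okubo algebra $\mathcal{O}$ is the 8-dimensional real vector space of $3\times 3$ complex Hermitian traceless matrices with product $x*y=\mu\, xy+\overline{\mu}\, yx-\frac13\mathrm{Tr}(xy)\,I_3$, where $\mu=\frac16(3+\mathrm{i}\sqrt3)$ and juxtaposition is the ordinary matrix product. Its norm is $n(x)=\frac16\mathrm{Tr}(x^2)$. The Okubic affine plane $\mathscr{A}_2(\mathcal{O})$ has as points the pairs $(x,y)\in\mathcal{O}\times\mathcal{O}$. Its lines are the sets $[s,t]=\{(x,s*x+t):x\in\mathcal{O}\}$ for $s,t\in\mathcal{O}$ ($s$ is called the slope, $t$ the offset), together with the vertical lines $[c]=\{c\}\times\mathcal{O}$ for $c\in\mathcal{O}$. Lines with the same slope are called parallel (a line is regarded as parallel to itself). *)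

theory Defs
  imports "HOL-Analysis.Analysis"
begin

definition cscale :: "complex \<Rightarrow> complex^3^3 \<Rightarrow> complex^3^3" where
  "cscale c A = (\<chi> i j. c * A $ i $ j)"

definition hermitian :: "complex^3^3 \<Rightarrow> bool" where
  "hermitian A \<longleftrightarrow> (\<forall>i j. A $ i $ j = cnj (A $ j $ i))"

lemma hermitianI: "(\<And>i j. cnj (A $ j $ i) = A $ i $ j) \<Longrightarrow> hermitian A"
  by (simp add: hermitian_def)

lemma hermitianD: "hermitian A \<Longrightarrow> cnj (A $ j $ i) = A $ i $ j"
  unfolding hermitian_def by (drule spec[of _ i], drule spec[of _ j], erule sym)

definition okubo_mu :: complex where
  "okubo_mu = (3 + \<i> * sqrt 3) / 6"

typedef okubo = "{A :: complex^3^3. hermitian A \<and> trace A = 0}"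
  morphisms okubo_matrix Abs_okubo
  by (rule exI[of _ 0]) (simp add: hermitian_def trace_def)

setup_lifting type_definition_okubo

instantiation okubo :: real_vector
begin

lift_definition zero_okubo :: okubo is 0
  by (simp add: hermitian_def trace_def)

lift_definition plus_okubo :: "okubo \<Rightarrow> okubo \<Rightarrow> okubo" is "(+)"
  by (auto simp: trace_add hermitianD intro!: hermitianI)

lift_definition minus_okubo :: "okubo \<Rightarrow> okubo \<Rightarrow> okubo" is "(-)"
  by (auto simp: trace_sub hermitianD intro!: hermitianI)

lift_definition uminus_okubo :: "okubo \<Rightarrow> okubo" is uminus
  by (auto simp: trace_def sum_negf hermitianD intro!: hermitianI)

lift_definition scaleR_okubo :: "real \<Rightarrow> okubo \<Rightarrow> okubo" is scaleR
  by (auto simp: trace_def hermitianD simp flip: scaleR_sum_right intro!: hermitianI)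

instance
proof
  fix x y z :: okubo and a b :: real
  show "x + y + z = x + (y + z)" by transfer (rule add.assoc)
  show "x + y = y + x" by transfer (rule add.commute)
  show "0 + x = x" by transfer (rule add_0_left)
  show "- x + x = 0" by transfer (rule left_minus)
  show "x - y = x + - y" by transfer (rule diff_conv_add_uminus)
  show "a *\<^sub>R (x + y) = a *\<^sub>R x + a *\<^sub>R y" by transfer (rule scaleR_add_right)
  show "(a + b) *\<^sub>R x = a *\<^sub>R x + b *\<^sub>R x" by transfer (rule scaleR_add_left)
  show "a *\<^sub>R b *\<^sub>R x = (a * b) *\<^sub>R x" by transfer (rule scaleR_scaleR)
  show "1 *\<^sub>R x = x" by transfer (rule scaleR_one)
qed

end

lemma trace_cscale: "trace (cscale c A) = c * trace A"
  by (simp add: trace_def cscale_def sum_distrib_left)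

lemma okubo_mu_add_cnj: "okubo_mu + cnj okubo_mu = 1"
  by (simp add: okubo_mu_def complex_eq_iff)

lemma hermitian_mult:
  assumes "hermitian A" "hermitian B"
  shows "cnj ((B ** A) $ j $ i) = (A ** B) $ i $ j"
proof -
  have "cnj (B $ j $ k * A $ k $ i) = A $ i $ k * B $ k $ j" for k
    using hermitianD[OF assms(1)] hermitianD[OF assms(2)] by (simp add: mult.commute)
  then show ?thesis
    by (simp add: matrix_matrix_mult_def)
qed

lemma hermitian_trace_mult_real:
  assumes "hermitian A" "hermitian B"
  shows "cnj (trace (A ** B)) = trace (A ** B)"
proof -
  have "cnj (trace (A ** B)) = trace (B ** A)"
    unfolding trace_def by (simp add: hermitian_mult assms)
  also have "\<dots> = trace (A ** B)"
    by (rule trace_mul_sym)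
  finally show ?thesis .
qed

lift_definition okubo_mult :: "okubo \<Rightarrow> okubo \<Rightarrow> okubo"  (infixl "\<star>" 70) is
  "\<lambda>x y. cscale okubo_mu (x ** y) + cscale (cnj okubo_mu) (y ** x)
          - cscale (trace (x ** y) / 3) (mat 1)"
proof -
  fix x y :: "complex^3^3"
  assume x: "hermitian x \<and> trace x = 0" and y: "hermitian y \<and> trace y = 0"
  let ?p = "cscale okubo_mu (x ** y) + cscale (cnj okubo_mu) (y ** x)
          - cscale (trace (x ** y) / 3) (mat 1)"
  have "hermitian ?p"
    using hermitian_trace_mult_real[of x y] x y
    by (intro hermitianI) (simp add: cscale_def mat_def hermitian_mult)
  moreover have "trace ?p = (okubo_mu + cnj okubo_mu) * trace (x ** y) - trace (x ** y)"
    by (simp add: trace_add trace_sub trace_cscale trace_I trace_mul_sym[of y x] distrib_right)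
  ultimately show "hermitian ?p \<and> trace ?p = 0"
    by (simp add: okubo_mu_add_cnj)
qed

text \<open>The trace of the square of a Hermitian matrix is real, so taking the real part only
  changes the type; see \<open>okubo_norm_complex\<close>.\<close>

definition okubo_norm :: "okubo \<Rightarrow> real" where
  "okubo_norm x = Re (trace (okubo_matrix x ** okubo_matrix x)) / 6"

lemma okubo_norm_complex:
  "complex_of_real (okubo_norm x) = trace (okubo_matrix x ** okubo_matrix x) / 6"
proof -
  have "trace (okubo_matrix x ** okubo_matrix x) \<in> \<real>"
    using hermitian_trace_mult_real okubo_matrix[of x] by (simp only: Reals_cnj_iff mem_Collect_eq)
  then show ?thesis
    by (simp add: okubo_norm_def)
qed

text \<open>The points of the affine plane are all elements of \<^typ>\<open>okubo \<times> okubo\<close>; lines are sets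
  of points.\<close>

definition okubic_line :: "okubo \<Rightarrow> okubo \<Rightarrow> (okubo \<times> okubo) set" where
  "okubic_line s t = {(x, s \<star> x + t) | x. True}"

definition okubic_vertical :: "okubo \<Rightarrow> (okubo \<times> okubo) set" where
  "okubic_vertical c = {c} \<times> UNIV"

definition okubic_lines :: "(okubo \<times> okubo) set set" where
  "okubic_lines = {okubic_line s t | s t. True} \<union> {okubic_vertical c | c. True}"

text \<open>Vertical lines have no slope, hence are parallel only to themselves.\<close>

definition has_slope :: "(okubo \<times> okubo) set \<Rightarrow> okubo \<Rightarrow> bool" where
  "has_slope L s \<longleftrightarrow> (\<exists>t. L = okubic_line s t)"

definition okubic_parallel :: "(okubo \<times> okubo) set \<Rightarrow> (okubo \<times> okubo) set \<Rightarrow> bool" where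
  "okubic_parallel L M \<longleftrightarrow> L \<in> okubic_lines \<and> M \<in> okubic_lines \<and>
     (L = M \<or> (\<exists>s. has_slope L s \<and> has_slope M s))"

end

theory Submission
  imports Defs
begin

text \<open>
  Everything rests on the two identities \<open>(x \<star> y) \<star> x = n(x) y = x \<star> (y \<star> x)\<close>
  (the Okubo algebra is a symmetric composition algebra) together with the fact that the norm
  \<open>n\<close> is anisotropic. They make left and right multiplication by any \<open>x \<noteq> 0\<close> bijective: up to the
  factor \<open>n(x)\<close>, the two multiplications by \<open>x\<close> are inverse to each other. Joining two points
  means solving \<open>s \<star> x = y\<close> for \<open>s\<close>, with \<open>x\<close> and \<open>y\<close> the differences of the coordinates; intersecting
  two lines means solving \<open>s \<star> x = t\<close> for \<open>x\<close>, with \<open>s\<close> the difference of the slopes and \<open>t\<close> that of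
  the offsets. The stated formulas are these solutions (\<open>okubo_mult_eq_iff_left\<close> and
  \<open>okubo_mult_eq_iff_right\<close>).

  The identities hold because \<open>\<mu> + cnj \<mu> = 1\<close> and \<open>\<mu> cnj \<mu> = 1/3\<close>, hence
  \<open>\<mu>\<^sup>2 + (cnj \<mu>)\<^sup>2 = 1/3\<close>: multiplying out \<open>(x \<star> y) \<star> x\<close> yields
  \<open>xxy + xyx + yxx\<close> with the common coefficient \<open>1/3\<close>, corrected by trace terms, and the polarised
  Cayley--Hamilton equation of traceless \<open>3 \<times> 3\<close> matrices reduces this to a multiple of \<open>y\<close>.
  The norm is anisotropic because the trace of the square of a Hermitian matrix is the
  sum of the squared absolute values of its entries.
\<close>

section \<open>Flexibility on the level of matrices\<close>

text \<open>A traceless \<open>3 \<times> 3\<close> matrix satisfies \<open>X\<^sup>3 = (Tr(X\<^sup>2) / 2) X + (Tr(X\<^sup>3) / 3) I\<close>, as its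
  determinant is \<open>Tr(X\<^sup>3) / 3\<close>. Putting \<open>X + Y\<close> for \<open>X\<close> and collecting the terms
  quadratic in \<open>X\<close> and linear in \<open>Y\<close> gives the equation below.\<close>

lemma polarised_cayley_hamilton_traceless:
  fixes X Y :: "complex^3^3"
  assumes "trace X = 0" "trace Y = 0"
  shows "X ** X ** Y + X ** Y ** X + Y ** X ** X =
    cscale (trace (X ** X) / 2) Y + cscale (trace (X ** Y)) X + cscale (trace (X ** X ** Y)) (mat 1)"
proof -
  have X: "X $ 3 $ 3 = - X $ 1 $ 1 - X $ 2 $ 2" and Y: "Y $ 3 $ 3 = - Y $ 1 $ 1 - Y $ 2 $ 2"
    using assms by (simp_all add: trace_def sum_3 eq_neg_iff_add_eq_0 algebra_simps)
  show ?thesis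
    by (simp add: vec_eq_iff forall_3 matrix_matrix_mult_def sum_3 trace_def cscale_def mat_def X Y)
       (simp add: field_simps)
qed

lemma matrix_mult_add_left: "(A + B) ** C = A ** C + B ** C"
  for A B C :: "complex^3^3"
  by (simp add: matrix_matrix_mult_def vec_eq_iff distrib_right sum.distrib)

lemma matrix_mult_diff:
  "(A - B) ** C = A ** C - B ** C" "C ** (A - B) = C ** A - C ** B"
  for A B C :: "complex^3^3"
  by (simp_all add: matrix_matrix_mult_def vec_eq_iff left_diff_distrib right_diff_distrib
      sum_subtractf)

lemma cscale_matrix_mult:
  "cscale c A ** B = cscale c (A ** B)" "B ** cscale c A = cscale c (B ** A)"
  by (simp_all add: cscale_def matrix_matrix_mult_def sum_distrib_left mult_ac)

text \<open>The parameters \<open>a\<close> and \<open>b\<close> are kept apart from \<open>\<mu>\<close> and its conjugate because exchanging them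
  gives the opposite product; thus one of the two identities implies the other.\<close>

definition okubo_matrix_mult :: "complex \<Rightarrow> complex \<Rightarrow> complex^3^3 \<Rightarrow> complex^3^3 \<Rightarrow> complex^3^3" where
  "okubo_matrix_mult a b X Y =
     cscale a (X ** Y) + cscale b (Y ** X) - cscale (trace (X ** Y) / 3) (mat 1)"

lemma okubo_matrix_mult_swap: "okubo_matrix_mult a b X Y = okubo_matrix_mult b a Y X"
  by (simp add: okubo_matrix_mult_def trace_mul_sym[of Y X] add.commute)

text \<open>Since \<open>a b\<close> and \<open>a\<^sup>2 + b\<^sup>2\<close> are both \<open>1/3\<close>, the cubic terms of the product combine to a
  third of the left-hand side of the polarised Cayley--Hamilton equation.\<close>

lemma okubo_matrix_mult_flexible:
  assumes ab: "a + b = 1" "a * b = 1 / 3" and tr: "trace X = 0" "trace Y = 0"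
  shows "okubo_matrix_mult a b (okubo_matrix_mult a b X Y) X = cscale (trace (X ** X) / 6) Y"
proof -
  define Z where "Z = okubo_matrix_mult a b X Y"
  have trXYX: "trace (X ** Y ** X) = trace (X ** X ** Y)"
    by (metis matrix_mul_assoc trace_mul_sym)
  have trYXX: "trace (Y ** X ** X) = trace (X ** X ** Y)"
    by (metis matrix_mul_assoc trace_mul_sym)
  have ZX: "Z ** X = cscale a (X ** Y ** X) + cscale b (Y ** X ** X) - cscale (trace (X ** Y) / 3) X"
    by (simp add: Z_def okubo_matrix_mult_def matrix_mult_add_left matrix_mult_diff
        cscale_matrix_mult)
  have XZ: "X ** Z = cscale a (X ** X ** Y) + cscale b (X ** Y ** X) - cscale (trace (X ** Y) / 3) X"
    by (simp add: Z_def okubo_matrix_mult_def matrix_add_ldistrib matrix_mult_diff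
        cscale_matrix_mult matrix_mul_assoc)
  have "trace (Z ** X) = (a + b) * trace (X ** X ** Y)"
    by (simp add: ZX trace_add trace_sub trace_cscale trXYX trYXX tr distrib_right)
  then have trZX: "trace (Z ** X) = trace (X ** X ** Y)"
    by (simp add: ab)
  have b: "b = 1 - a"
    using ab(1) by (simp add: eq_diff_eq add.commute)
  have a2: "a * a = a - 1 / 3"
    using ab(2) unfolding b by algebra
  have "okubo_matrix_mult a b Z X $ i $ j = cscale (trace (X ** X) / 6) Y $ i $ j" for i j
  proof -
    have CH: "(X ** X ** Y) $ i $ j + (X ** Y ** X) $ i $ j + (Y ** X ** X) $ i $ j =
        trace (X ** X) / 2 * Y $ i $ j + trace (X ** Y) * X $ i $ j
        + trace (X ** X ** Y) * mat 1 $ i $ j"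
      using arg_cong[OF polarised_cayley_hamilton_traceless[OF tr], of "\<lambda>M. M $ i $ j"]
      by (simp add: cscale_def)
    have collect: "a * (a * q + b * r - t / 3) + b * (a * p + b * q - t / 3) =
        (p + q + r) / 3 - t / 3" for p q r t
      using a2 unfolding b by algebra
    have "okubo_matrix_mult a b Z X $ i $ j =
        ((X ** X ** Y) $ i $ j + (X ** Y ** X) $ i $ j + (Y ** X ** X) $ i $ j) / 3
        - trace (X ** Y) / 3 * X $ i $ j - trace (X ** X ** Y) / 3 * mat 1 $ i $ j"
      unfolding okubo_matrix_mult_def[of a b Z X] trZX unfolding ZX XZ
      by (simp add: cscale_def collect)
    then show ?thesis
      by (simp add: CH cscale_def) (simp add: field_simps)
  qed
  then show ?thesis
    by (simp add: vec_eq_iff Z_def)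
qed

section \<open>The Okubo algebra is a division algebra\<close>

lemma okubo_mu_mult_cnj: "okubo_mu * cnj okubo_mu = 1 / 3"
  by (simp add: okubo_mu_def complex_eq_iff field_simps)

lemma okubo_matrix_okubo_mult:
  "okubo_matrix (x \<star> y) =
    okubo_matrix_mult okubo_mu (cnj okubo_mu) (okubo_matrix x) (okubo_matrix y)"
  by (simp add: okubo_mult.rep_eq okubo_matrix_mult_def)

lemma trace_okubo_matrix: "trace (okubo_matrix x) = 0"
  using okubo_matrix[of x] by simp

lemma okubo_matrix_scaleR_norm:
  "okubo_matrix (okubo_norm x *\<^sub>R y) =
    cscale (trace (okubo_matrix x ** okubo_matrix x) / 6) (okubo_matrix y)"
  unfolding okubo_norm_complex[symmetric]
  by (simp add: scaleR_okubo.rep_eq cscale_def vec_eq_iff)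
     (simp add: scaleR_conv_of_real)

lemma okubo_mult_flexible_left: "(x \<star> y) \<star> x = okubo_norm x *\<^sub>R y"
  unfolding okubo_matrix_inject[symmetric] okubo_matrix_okubo_mult okubo_matrix_scaleR_norm
  by (intro okubo_matrix_mult_flexible okubo_mu_add_cnj okubo_mu_mult_cnj trace_okubo_matrix)

lemma okubo_mult_flexible_right: "x \<star> (y \<star> x) = okubo_norm x *\<^sub>R y"
proof -
  let ?X = "okubo_matrix x" and ?Y = "okubo_matrix y" and ?\<mu> = okubo_mu and ?\<nu> = "cnj okubo_mu"
  have "okubo_matrix (x \<star> (y \<star> x)) = okubo_matrix_mult ?\<nu> ?\<mu> (okubo_matrix_mult ?\<nu> ?\<mu> ?X ?Y) ?X"
    by (simp add: okubo_matrix_okubo_mult okubo_matrix_mult_swap[of ?\<mu> ?\<nu>])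
  also have "\<dots> = okubo_matrix (okubo_norm x *\<^sub>R y)"
    unfolding okubo_matrix_scaleR_norm
    using okubo_mu_add_cnj okubo_mu_mult_cnj
    by (intro okubo_matrix_mult_flexible trace_okubo_matrix) (simp_all add: add.commute mult.commute)
  finally show ?thesis
    by (simp add: okubo_matrix_inject)
qed

lemma okubo_norm_eq_sum:
  "okubo_norm x = (\<Sum>i\<in>UNIV. \<Sum>j\<in>UNIV. (cmod (okubo_matrix x $ i $ j))\<^sup>2) / 6"
proof -
  have "okubo_matrix x $ j $ i = cnj (okubo_matrix x $ i $ j)" for i j
    using okubo_matrix[of x] by (simp add: hermitianD)
  then have "okubo_matrix x $ i $ j * okubo_matrix x $ j $ i =
      of_real ((cmod (okubo_matrix x $ i $ j))\<^sup>2)" for i j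
    by (metis complex_norm_square)
  then show ?thesis
    by (simp add: okubo_norm_def trace_def matrix_matrix_mult_def)
qed

lemma okubo_norm_eq_0_iff: "okubo_norm x = 0 \<longleftrightarrow> x = 0"
proof
  assume "okubo_norm x = 0"
  then have "okubo_matrix x = 0"
    by (simp add: okubo_norm_eq_sum sum_nonneg_eq_0_iff sum_nonneg vec_eq_iff)
  then show "x = 0"
    by (simp add: okubo_matrix_inject[symmetric] zero_okubo.rep_eq)
qed (simp add: okubo_norm_def zero_okubo.rep_eq trace_def)

lemma okubo_mult_add_left: "(x + y) \<star> z = x \<star> z + y \<star> z"
  by (simp add: okubo_matrix_inject[symmetric] okubo_mult.rep_eq plus_okubo.rep_eq trace_add
      matrix_add_ldistrib matrix_mult_add_left)
     (simp add: cscale_def vec_eq_iff algebra_simps add_divide_distrib)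

lemma okubo_mult_add_right: "x \<star> (y + z) = x \<star> y + x \<star> z"
  by (simp add: okubo_matrix_inject[symmetric] okubo_mult.rep_eq plus_okubo.rep_eq trace_add
      matrix_add_ldistrib matrix_mult_add_left)
     (simp add: cscale_def vec_eq_iff algebra_simps add_divide_distrib)

lemma okubo_mult_diff_left: "(x - y) \<star> z = x \<star> z - y \<star> z"
  using okubo_mult_add_left[of "x - y" y z] by (simp add: eq_diff_eq)

lemma okubo_mult_diff_right: "x \<star> (y - z) = x \<star> y - x \<star> z"
  using okubo_mult_add_right[of x "y - z" z] by (simp add: eq_diff_eq)

lemma okubo_matrix_mult_scaleR:
  "(r *\<^sub>R A) ** B = r *\<^sub>R (A ** B)" "A ** (r *\<^sub>R B) = r *\<^sub>R (A ** B)" for A B :: "complex^3^3"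
  by (simp_all add: matrix_matrix_mult_def vec_eq_iff scaleR_sum_right)

lemma okubo_mult_scaleR_left: "(r *\<^sub>R x) \<star> y = r *\<^sub>R (x \<star> y)"
  by (simp add: okubo_matrix_inject[symmetric] okubo_mult.rep_eq scaleR_okubo.rep_eq
      okubo_matrix_mult_scaleR)
     (simp add: cscale_def vec_eq_iff trace_def scaleR_diff_right scaleR_add_right
      flip: scaleR_sum_right)

lemma okubo_mult_scaleR_right: "x \<star> (r *\<^sub>R y) = r *\<^sub>R (x \<star> y)"
  by (simp add: okubo_matrix_inject[symmetric] okubo_mult.rep_eq scaleR_okubo.rep_eq
      okubo_matrix_mult_scaleR)
     (simp add: cscale_def vec_eq_iff trace_def scaleR_diff_right scaleR_add_right
      flip: scaleR_sum_right)

lemma okubo_mult_eq_iff_left: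
  assumes "x \<noteq> 0"
  shows "s \<star> x = y \<longleftrightarrow> s = (x \<star> y) /\<^sub>R okubo_norm x"
  using assms okubo_mult_flexible_left[of x y] okubo_mult_flexible_right[of x s]
  by (auto simp: okubo_norm_eq_0_iff okubo_mult_scaleR_left)

lemma okubo_mult_eq_iff_right:
  assumes "s \<noteq> 0"
  shows "s \<star> x = t \<longleftrightarrow> x = (t \<star> s) /\<^sub>R okubo_norm s"
  using assms okubo_mult_flexible_left[of s x] okubo_mult_flexible_right[of s t]
  by (auto simp: okubo_norm_eq_0_iff okubo_mult_scaleR_right)

section \<open>The affine plane\<close>

lemma mem_okubic_line: "(x, y) \<in> okubic_line s t \<longleftrightarrow> y = s \<star> x + t"
  by (auto simp: okubic_line_def)

lemma mem_okubic_vertical: "(x, y) \<in> okubic_vertical c \<longleftrightarrow> x = c"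
  by (auto simp: okubic_vertical_def)

lemma okubic_lines_cases:
  assumes "L \<in> okubic_lines"
  obtains (sloped) s t where "L = okubic_line s t" | (vertical) c where "L = okubic_vertical c"
  using assms by (auto simp: okubic_lines_def)

lemma okubic_line_in_lines: "okubic_line s t \<in> okubic_lines"
  and okubic_vertical_in_lines: "okubic_vertical c \<in> okubic_lines"
  by (auto simp: okubic_lines_def)

lemma points_on_okubic_line_iff:
  assumes "x1 \<noteq> x2"
  shows "(x1, y1) \<in> okubic_line s t \<and> (x2, y2) \<in> okubic_line s t \<longleftrightarrow>
    s = ((x1 - x2) \<star> (y1 - y2)) /\<^sub>R okubo_norm (x1 - x2) \<and> t = y1 - s \<star> x1"
proof -
  have "(x1, y1) \<in> okubic_line s t \<and> (x2, y2) \<in> okubic_line s t \<longleftrightarrow>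
      s \<star> (x1 - x2) = y1 - y2 \<and> t = y1 - s \<star> x1"
    by (auto simp: mem_okubic_line okubo_mult_diff_right algebra_simps)
  then show ?thesis
    using assms by (simp add: okubo_mult_eq_iff_left)
qed

lemma okubic_lines_meet_iff:
  assumes "s1 \<noteq> s2"
  shows "p \<in> okubic_line s1 t1 \<and> p \<in> okubic_line s2 t2 \<longleftrightarrow>
    (let x = ((t2 - t1) \<star> (s1 - s2)) /\<^sub>R okubo_norm (s1 - s2) in p = (x, s1 \<star> x + t1))"
proof -
  obtain x y where p: "p = (x, y)"
    by (cases p)
  have "p \<in> okubic_line s1 t1 \<and> p \<in> okubic_line s2 t2 \<longleftrightarrow>
      (s1 - s2) \<star> x = t2 - t1 \<and> y = s1 \<star> x + t1"
    by (auto simp: p mem_okubic_line okubo_mult_diff_left algebra_simps)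
  then show ?thesis
    using assms by (auto simp: p okubo_mult_eq_iff_right Let_def)
qed

text \<open>The slope is determined by the line as a set of points. This is what makes parallelism to a
  given line \<open>[s, t]\<close> mean having slope \<open>s\<close>.\<close>

lemma okubic_line_eq_iff: "okubic_line s t = okubic_line s' t' \<longleftrightarrow> s = s' \<and> t = t'"
proof
  assume eq: "okubic_line s t = okubic_line s' t'"
  have "s = s'"
  proof (rule ccontr)
    assume "s \<noteq> s'"
    \<comment> \<open>Lines of distinct slopes share exactly one point, but a line has a point over every
      abscissa, and \<open>0\<close> and \<open>s - s'\<close> are distinct.\<close>
    have "(x, s \<star> x + t) \<in> okubic_line s t \<and> (x, s \<star> x + t) \<in> okubic_line s' t'" for x
      unfolding eq[symmetric] by (simp add: mem_okubic_line)
    then have "x = ((t' - t) \<star> (s - s')) /\<^sub>R okubo_norm (s - s')" for x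
      unfolding okubic_lines_meet_iff[OF \<open>s \<noteq> s'\<close>] Let_def by blast
    then have "s - s' = 0"
      by metis
    with \<open>s \<noteq> s'\<close> show False
      by simp
  qed
  moreover have "(0, s \<star> 0 + t) \<in> okubic_line s' t'"
    unfolding eq[symmetric] by (simp add: mem_okubic_line)
  ultimately show "s = s' \<and> t = t'"
    by (simp add: mem_okubic_line)
qed simp

lemma parallel_okubic_line_iff:
  "okubic_parallel L (okubic_line s t) \<longleftrightarrow> (\<exists>u. L = okubic_line s u)"
  by (auto simp: okubic_parallel_def has_slope_def okubic_line_eq_iff okubic_line_in_lines)

lemma unique_joining_line:
  assumes "(x1, y1) \<noteq> (x2, y2)"
  shows "\<exists>!L. L \<in> okubic_lines \<and> (x1, y1) \<in> L \<and> (x2, y2) \<in> L"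
proof (cases "x1 = x2")
  case True
  show ?thesis
  proof (rule ex1I[of _ "okubic_vertical x1"])
    fix L assume L: "L \<in> okubic_lines \<and> (x1, y1) \<in> L \<and> (x2, y2) \<in> L"
    then have "L \<in> okubic_lines"
      by simp
    then show "L = okubic_vertical x1"
      by (cases rule: okubic_lines_cases)
         (use L True assms in \<open>auto simp: mem_okubic_line mem_okubic_vertical\<close>)
  qed (simp add: True okubic_vertical_in_lines mem_okubic_vertical)
next
  case False
  define s where "s = ((x1 - x2) \<star> (y1 - y2)) /\<^sub>R okubo_norm (x1 - x2)"
  show ?thesis
  proof (rule ex1I[of _ "okubic_line s (y1 - s \<star> x1)"])
    fix L assume L: "L \<in> okubic_lines \<and> (x1, y1) \<in> L \<and> (x2, y2) \<in> L"
    then have "L \<in> okubic_lines"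
      by simp
    then show "L = okubic_line s (y1 - s \<star> x1)"
    proof (cases rule: okubic_lines_cases)
      case (sloped s' t')
      then show ?thesis
        using L points_on_okubic_line_iff[OF False, of y1 s' t' y2] by (simp add: s_def)
    next
      case (vertical c)
      then show ?thesis
        using L False by (simp add: mem_okubic_vertical)
    qed
  next
    show "okubic_line s (y1 - s \<star> x1) \<in> okubic_lines \<and> (x1, y1) \<in> okubic_line s (y1 - s \<star> x1) \<and>
        (x2, y2) \<in> okubic_line s (y1 - s \<star> x1)"
      unfolding points_on_okubic_line_iff[OF False] by (simp add: s_def okubic_line_in_lines)
  qed
qed

theorem mainTheorem2:
  shows
    "(\<forall>x1 y1 x2 y2. (x1, y1) \<noteq> (x2, y2) \<longrightarrow>
        (\<exists>!L. L \<in> okubic_lines \<and> (x1, y1) \<in> L \<and> (x2, y2) \<in> L) \<and>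
        (x1 \<noteq> x2 \<longrightarrow>
          (let s = ((x1 - x2) \<star> (y1 - y2)) /\<^sub>R okubo_norm (x1 - x2)
           in (x1, y1) \<in> okubic_line s (y1 - s \<star> x1) \<and>
              (x2, y2) \<in> okubic_line s (y1 - s \<star> x1))) \<and>
        (x1 = x2 \<longrightarrow>
          (x1, y1) \<in> okubic_vertical x1 \<and> (x2, y2) \<in> okubic_vertical x1))
     \<and>
     (\<forall>s1 t1 s2 t2. s1 \<noteq> s2 \<longrightarrow>
        (\<exists>!p. p \<in> okubic_line s1 t1 \<and> p \<in> okubic_line s2 t2) \<and>
        (let x = ((t2 - t1) \<star> (s1 - s2)) /\<^sub>R okubo_norm (s1 - s2)
         in (x, s1 \<star> x + t1) \<in> okubic_line s1 t1 \<and>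
            (x, s1 \<star> x + t1) \<in> okubic_line s2 t2))
     \<and>
     (\<forall>L M s. has_slope L s \<and> has_slope M s \<and> L \<noteq> M \<longrightarrow> L \<inter> M = {})
     \<and>
     (\<forall>s t x y.
        (\<exists>!L. L \<in> okubic_lines \<and> (x, y) \<in> L \<and> okubic_parallel L (okubic_line s t)) \<and>
        (x, y) \<in> okubic_line s (y - s \<star> x) \<and>
        okubic_parallel (okubic_line s (y - s \<star> x)) (okubic_line s t))"
proof (intro conjI allI impI)
  fix x1 y1 x2 y2 :: okubo
  assume "(x1, y1) \<noteq> (x2, y2)"
  then show "\<exists>!L. L \<in> okubic_lines \<and> (x1, y1) \<in> L \<and> (x2, y2) \<in> L"
    by (rule unique_joining_line)
next
  fix x1 y1 x2 y2 :: okubo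
  assume "x1 \<noteq> x2"
  then show "let s = ((x1 - x2) \<star> (y1 - y2)) /\<^sub>R okubo_norm (x1 - x2)
      in (x1, y1) \<in> okubic_line s (y1 - s \<star> x1) \<and> (x2, y2) \<in> okubic_line s (y1 - s \<star> x1)"
    unfolding Let_def by (subst points_on_okubic_line_iff) simp_all
next
  fix x1 y1 x2 y2 :: okubo
  assume "x1 = x2"
  then show "(x1, y1) \<in> okubic_vertical x1" "(x2, y2) \<in> okubic_vertical x1"
    by (simp_all add: mem_okubic_vertical)
next
  fix s1 t1 s2 t2 :: okubo
  assume "s1 \<noteq> s2"
  then show "\<exists>!p. p \<in> okubic_line s1 t1 \<and> p \<in> okubic_line s2 t2"
    by (simp add: okubic_lines_meet_iff Let_def)
  from \<open>s1 \<noteq> s2\<close> show "let x = ((t2 - t1) \<star> (s1 - s2)) /\<^sub>R okubo_norm (s1 - s2)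
      in (x, s1 \<star> x + t1) \<in> okubic_line s1 t1 \<and> (x, s1 \<star> x + t1) \<in> okubic_line s2 t2"
    unfolding Let_def by (subst okubic_lines_meet_iff) (simp_all add: Let_def)
next
  fix L M s
  assume "has_slope L s \<and> has_slope M s \<and> L \<noteq> M"
  then show "L \<inter> M = {}"
    by (auto simp: has_slope_def okubic_line_def)
next
  fix s t x y :: okubo
  show "\<exists>!L. L \<in> okubic_lines \<and> (x, y) \<in> L \<and> okubic_parallel L (okubic_line s t)"
    by (rule ex1I[of _ "okubic_line s (y - s \<star> x)"])
       (auto simp: parallel_okubic_line_iff okubic_line_in_lines mem_okubic_line)
  show "(x, y) \<in> okubic_line s (y - s \<star> x)"
    by (simp add: mem_okubic_line)
  show "okubic_parallel (okubic_line s (y - s \<star> x)) (okubic_line s t)"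
    by (auto simp: parallel_okubic_line_iff)
qed

end
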